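(* Let $f:\mathbb{R}^n_{\ge 0} \rightarrow \mathbb{R}^n_{\ge 0}$ be an m-topical map. \begin{enumerate} \item[(1)] If $f$ is facially irreducible or graphically irreducible, then $f$ is indecomposable. \item[(2)] If $f$ is m-convex and indecomposable, then $f$ is graphically irreducible. \item[(3)] If $f$ is subadditive and indecomposable, then $f$ is facially irreducible. \end{enumerate}
   Context: Notation: $[n]=\{1,\dots,n\}$; $\mathbb{R}^n_{\ge 0}=[0,\infty)^n$ and $\mathbb{R}^n_{>0}=(0,\infty)^n$; $x\le y$ means $x_i\le y_i$ for all $i\in[n]$; $\mathbf{1}\in\mathbb{R}^n$ is the all-ones vector; for $J\subseteq[n]$, $e_J\in\mathbb{R}^n$ has entries $(e_J)_i=1$ if $i\in J$ and $0$ otherwise. A map $f:\mathbb{R}^n_{\ge 0}\to\mathbb{R}^n_{\ge 0}$ is m-topical (multiplicatively topical) if it is continuous, order-preserving ($x\le y$ implies $f(x)\le f(y)$), homogeneous ($f(\lambda x)=\lambda f(x)$ for all real $\lambda>0$), and satisfies $f(\mathbb{R}^n_{>0})\subseteq\mathbb{R}^n_{>0}$. $f$ is subadditive if $f(x+y)\le f(x)+f(y)$ for all $x,y\in\mathbb{R}^n_{\ge 0}$. An m-topical map $f$ is m-convex (multiplicatively convex) if $f(x^\lambda y^{1-\lambda})\le f(x)^\lambda f(y)^{1-\lambda}$ for all $x,y\in\mathbb{R}^n_{>0}$ and $0<\lambda<1$, with powers and products taken entrywise. For $J\subseteq[n]$ the closed face $F_J$ is $\{x\in\mathbb{R}^n_{\ge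 0}: x_i=0 \text{ for all } i\notin J\}$; it is proper if $J\ne[n]$ and nontrivial if $J\neq\varnothing$. An m-topical map $f$ is facially irreducible if it leaves no nontrivial proper closed face invariant, i.e. there is no $J$ with $\varnothing\ne J\subsetneq[n]$ and $f(F_J)\subseteq F_J$. The directed graph $G(f)$ has node set $[n]$ and an arc from $i$ to $j$ if and only if $\lim_{t\to\infty}f(\mathbf{1}+te_{\{j\}})_i=\infty$. The map $f$ is graphically irreducible if $G(f)$ is strongly connected. The map $f$ is decomposable if there is a nonempty proper subset $J\subset[n]$ such that $\lim_{t\to\infty}f(\mathbf{1}+te_J)_i<\infty$ for all $i\in[n]\setminus J$; it is indecomposable if it is not decomposable. *)

theory Defs
  imports "HOL-Analysis.Analysis" "Graph_Theory.Digraph_Component"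
begin

definition nonneg_orthant :: "(real ^ 'n) set" where
  "nonneg_orthant = {x. \<forall>i. 0 \<le> x $ i}"

text \<open>The strict order of the library on \<open>real ^ 'n\<close> is not the entrywise strict order,
  so positivity is stated entrywise. The library order \<open>\<le>\<close> is the entrywise one, and
  \<open>1\<close> is the all-ones vector.\<close>

definition pos_orthant :: "(real ^ 'n) set" where
  "pos_orthant = {x. \<forall>i. 0 < x $ i}"

definition ind_vec :: "'n set \<Rightarrow> real ^ 'n" where
  "ind_vec J = (\<chi> i. if i \<in> J then 1 else 0)"

text \<open>A map on the nonnegative orthant is represented by a function on all of
  \<open>real ^ 'n\<close>; none of the notions below depends on its values outside the orthant.\<close>

definition m_topical :: "(real ^ 'n \<Rightarrow> real ^ 'n) \<Rightarrow> bool" where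
  "m_topical f \<longleftrightarrow>
     f ` nonneg_orthant \<subseteq> nonneg_orthant \<and>
     continuous_on nonneg_orthant f \<and>
     (\<forall>x\<in>nonneg_orthant. \<forall>y\<in>nonneg_orthant. x \<le> y \<longrightarrow> f x \<le> f y) \<and>
     (\<forall>c>0. \<forall>x\<in>nonneg_orthant. f (c *\<^sub>R x) = c *\<^sub>R f x) \<and>
     f ` pos_orthant \<subseteq> pos_orthant"

definition subadditive_map :: "(real ^ 'n \<Rightarrow> real ^ 'n) \<Rightarrow> bool" where
  "subadditive_map f \<longleftrightarrow>
     (\<forall>x\<in>nonneg_orthant. \<forall>y\<in>nonneg_orthant. f (x + y) \<le> f x + f y)"

text \<open>The weighted entrywise geometric mean of \<open>x\<close> and \<open>y\<close>; meant for positive vectors.\<close>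

definition geom_mean :: "real \<Rightarrow> real ^ 'n \<Rightarrow> real ^ 'n \<Rightarrow> real ^ 'n" where
  "geom_mean c x y = (\<chi> i. (x $ i) powr c * (y $ i) powr (1 - c))"

definition m_convex :: "(real ^ 'n \<Rightarrow> real ^ 'n) \<Rightarrow> bool" where
  "m_convex f \<longleftrightarrow>
     (\<forall>x\<in>pos_orthant. \<forall>y\<in>pos_orthant. \<forall>c. 0 < c \<and> c < 1 \<longrightarrow>
        f (geom_mean c x y) \<le> geom_mean c (f x) (f y))"

definition closed_face :: "'n set \<Rightarrow> (real ^ 'n) set" where
  "closed_face J = {x \<in> nonneg_orthant. \<forall>i. i \<notin> J \<longrightarrow> x $ i = 0}"

definition facially_irreducible :: "(real ^ 'n \<Rightarrow> real ^ 'n) \<Rightarrow> bool" where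
  "facially_irreducible f \<longleftrightarrow>
     \<not> (\<exists>J. J \<noteq> {} \<and> J \<noteq> UNIV \<and> f ` closed_face J \<subseteq> closed_face J)"

definition map_digraph :: "(real ^ 'n \<Rightarrow> real ^ 'n) \<Rightarrow> ('n, 'n \<times> 'n) pre_digraph" where
  "map_digraph f =
     \<lparr> verts = UNIV,
       arcs = {(i, j). filterlim (\<lambda>t. f (1 + t *\<^sub>R ind_vec {j}) $ i) at_top at_top},
       tail = fst,
       head = snd \<rparr>"

text \<open>Reachability in a digraph is reflexive, so a graph with one node is strongly
  connected even without a loop.\<close>

definition graphically_irreducible :: "(real ^ 'n \<Rightarrow> real ^ 'n) \<Rightarrow> bool" where
  "graphically_irreducible f \<longleftrightarrow> strongly_connected (map_digraph f)"

text \<open>That a limit is finite means that the function converges to some real number.\<close>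

definition decomposable :: "(real ^ 'n \<Rightarrow> real ^ 'n) \<Rightarrow> bool" where
  "decomposable f \<longleftrightarrow>
     (\<exists>J. J \<noteq> {} \<and> J \<noteq> UNIV \<and>
        (\<forall>i. i \<notin> J \<longrightarrow> (\<exists>L. ((\<lambda>t. f (1 + t *\<^sub>R ind_vec J) $ i) \<longlongrightarrow> L) at_top)))"

abbreviation indecomposable :: "(real ^ 'n \<Rightarrow> real ^ 'n) \<Rightarrow> bool" where
  "indecomposable f \<equiv> \<not> decomposable f"

end

theory Submission imports Defs begin

text \<open>
  By monotonicity, \<open>t \<mapsto> f (1 + t e\<^sub>J)\<^sub>i\<close> either converges or tends to infinity, so \<open>f\<close> is
  decomposable through \<open>J\<close> iff these functions are bounded for all \<open>i\<close> outside \<open>J\<close>.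
  Such a bound \<open>L\<close> gives \<open>f (e\<^sub>J)\<^sub>i \<le> L / t\<close> by homogeneity, so the face of \<open>J\<close> is invariant, and it
  forbids arcs from outside \<open>J\<close> into \<open>J\<close>. Conversely, if the face is invariant and \<open>f\<close> is
  subadditive, then \<open>f (1 + t e\<^sub>J)\<^sub>i \<le> f (1)\<^sub>i\<close>. If \<open>f\<close> is m-convex and no arc enters \<open>J\<close>, the bounds
  for the single elements of \<open>J\<close> combine to one for \<open>J\<close>, because \<open>1 + t e\<^sub>J\<close> is a geometric mean
  of vectors \<open>1 + s e\<^sub>j\<close> with \<open>j \<in> J\<close>.
\<close>

section \<open>Monotone real functions at infinity\<close>

lemma mono_on_tendsto_SUP_at_top:
  fixes F :: "real \<Rightarrow> real"
  assumes mono: "mono_on {a..} F" and bdd: "bdd_above (F ` {a..})"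
  shows "(F \<longlongrightarrow> (SUP t\<in>{a..}. F t)) at_top"
proof (rule increasing_tendsto)
  show "\<forall>\<^sub>F t in at_top. F t \<le> (SUP t\<in>{a..}. F t)"
    using eventually_ge_at_top[of a] by eventually_elim (auto intro: cSUP_upper bdd)
next
  fix x assume "x < (SUP t\<in>{a..}. F t)"
  then obtain s where s: "s \<ge> a" "x < F s"
    using less_cSUP_iff[OF _ bdd] by auto
  show "\<forall>\<^sub>F t in at_top. x < F t"
    using eventually_ge_at_top[of s]
  proof eventually_elim
    case (elim t)
    then have "F s \<le> F t" using s by (intro mono_onD[OF mono]) auto
    then show ?case using s by simp
  qed
qed

lemma not_tendsto_if_filterlim_at_top:
  fixes F :: "real \<Rightarrow> real"
  assumes "filterlim F at_top at_top"
  shows "\<not> (F \<longlongrightarrow> L) at_top"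
  using not_tendsto_and_filterlim_at_infinity[OF trivial_limit_at_top_linorder]
    filterlim_at_top_imp_at_infinity[OF assms] by fast

text \<open>If unbounded, \<open>F\<close> exceeds any \<open>Z\<close> at some point, and
  monotonicity keeps it above \<open>Z\<close> from there on. If bounded, \<open>F\<close> tends to
  its supremum, which rules out divergence.\<close>

lemma mono_on_filterlim_at_top_iff:
  fixes F :: "real \<Rightarrow> real"
  assumes mono: "mono_on {a..} F"
  shows "filterlim F at_top at_top \<longleftrightarrow> \<not> bdd_above (F ` {a..})"
proof
  assume "\<not> bdd_above (F ` {a..})"
  then have *: "\<exists>s\<ge>a. Z < F s" for Z
    by (force simp: bdd_above_def not_le)
  show "filterlim F at_top at_top"
    unfolding filterlim_at_top
  proof
    fix Z
    obtain s where s: "s \<ge> a" "Z < F s" using * by blast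
    show "\<forall>\<^sub>F t in at_top. Z \<le> F t"
      using eventually_ge_at_top[of s]
    proof eventually_elim
      case (elim t)
      then have "F s \<le> F t" using s by (intro mono_onD[OF mono]) auto
      then show ?case using s by simp
    qed
  qed
next
  assume "filterlim F at_top at_top"
  then show "\<not> bdd_above (F ` {a..})"
    using mono_on_tendsto_SUP_at_top[OF mono] not_tendsto_if_filterlim_at_top by fast
qed

lemma mono_on_convergent_at_top_iff:
  fixes F :: "real \<Rightarrow> real"
  assumes mono: "mono_on {a..} F"
  shows "(\<exists>L. (F \<longlongrightarrow> L) at_top) \<longleftrightarrow> bdd_above (F ` {a..})"
proof
  assume "\<exists>L. (F \<longlongrightarrow> L) at_top"
  then have "\<not> filterlim F at_top at_top"
    using not_tendsto_if_filterlim_at_top by fast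
  then show "bdd_above (F ` {a..})" by (simp add: mono_on_filterlim_at_top_iff[OF mono])
next
  assume "bdd_above (F ` {a..})"
  then show "\<exists>L. (F \<longlongrightarrow> L) at_top"
    using mono_on_tendsto_SUP_at_top[OF mono] by (intro exI)
qed

section \<open>Rays in the orthant and their images under m-topical maps\<close>

lemma one_plus_ind_vec_nonneg:
  "0 \<le> t \<Longrightarrow> 1 + t *\<^sub>R ind_vec J \<in> nonneg_orthant"
  by (simp add: nonneg_orthant_def ind_vec_def)

lemma one_plus_ind_vec_pos:
  "0 \<le> t \<Longrightarrow> 1 + t *\<^sub>R ind_vec J \<in> pos_orthant"
  by (simp add: pos_orthant_def ind_vec_def)

lemma ind_vec_nonneg: "ind_vec J \<in> nonneg_orthant"
  by (simp add: nonneg_orthant_def ind_vec_def)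

lemma one_nonneg_orthant: "1 \<in> nonneg_orthant"
  by (simp add: nonneg_orthant_def)

lemma scaleR_nonneg_orthant:
  "0 \<le> c \<Longrightarrow> x \<in> nonneg_orthant \<Longrightarrow> c *\<^sub>R x \<in> nonneg_orthant"
  by (simp add: nonneg_orthant_def)

context
  fixes f :: "real ^ 'n \<Rightarrow> real ^ 'n"
  assumes top: "m_topical f"
begin

lemma topical_nonneg: "x \<in> nonneg_orthant \<Longrightarrow> f x \<in> nonneg_orthant"
  using top by (auto simp: m_topical_def)

lemma topical_pos: "x \<in> pos_orthant \<Longrightarrow> f x \<in> pos_orthant"
  using top by (auto simp: m_topical_def)

lemma topical_mono:
  "x \<in> nonneg_orthant \<Longrightarrow> y \<in> nonneg_orthant \<Longrightarrow> x \<le> y \<Longrightarrow> f x $ i \<le> f y $ i"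
  using top by (auto simp: m_topical_def less_eq_vec_def)

lemma topical_homogeneous:
  "0 < c \<Longrightarrow> x \<in> nonneg_orthant \<Longrightarrow> f (c *\<^sub>R x) $ i = c * f x $ i"
  using top by (auto simp: m_topical_def)

lemma mono_on_ray: "mono_on {0..} (\<lambda>t. f (1 + t *\<^sub>R ind_vec J) $ i)"
proof (rule mono_onI)
  fix r s :: real assume "r \<in> {0..}" "s \<in> {0..}" "r \<le> s"
  then show "f (1 + r *\<^sub>R ind_vec J) $ i \<le> f (1 + s *\<^sub>R ind_vec J) $ i"
    by (intro topical_mono one_plus_ind_vec_nonneg) (auto simp: less_eq_vec_def ind_vec_def)
qed

text \<open>A common replacement for both limit conditions: since the ray images are monotone, a
  finite limit means bounded and an infinite one means unbounded. No limits occur after the two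
  translations below.\<close>

definition bounded_ray :: "'n set \<Rightarrow> 'n \<Rightarrow> bool" where
  "bounded_ray J i \<longleftrightarrow> bdd_above ((\<lambda>t. f (1 + t *\<^sub>R ind_vec J) $ i) ` {0..})"

lemma bounded_rayI:
  "(\<And>t. 0 \<le> t \<Longrightarrow> f (1 + t *\<^sub>R ind_vec J) $ i \<le> B) \<Longrightarrow> bounded_ray J i"
  by (auto simp: bounded_ray_def intro!: bdd_aboveI)

lemma bounded_rayE:
  assumes "bounded_ray J i"
  obtains B where "\<And>t. 0 \<le> t \<Longrightarrow> f (1 + t *\<^sub>R ind_vec J) $ i \<le> B"
  using assms by (fastforce simp: bounded_ray_def bdd_above_def)

lemma decomposable_iff_bounded_ray:
  "decomposable f \<longleftrightarrow> (\<exists>J. J \<noteq> {} \<and> J \<noteq> UNIV \<and> (\<forall>i. i \<notin> J \<longrightarrow> bounded_ray J i))"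
  unfolding decomposable_def bounded_ray_def
  by (simp add: mono_on_convergent_at_top_iff[OF mono_on_ray])

lemma arc_iff_not_bounded_ray:
  "i \<rightarrow>\<^bsub>map_digraph f\<^esub> j \<longleftrightarrow> \<not> bounded_ray {j} i"
proof -
  have "i \<rightarrow>\<^bsub>map_digraph f\<^esub> j
      \<longleftrightarrow> filterlim (\<lambda>t. f (1 + t *\<^sub>R ind_vec {j}) $ i) at_top at_top"
    by (auto simp: arcs_ends_def arc_to_ends_def map_digraph_def image_iff)
  then show ?thesis
    unfolding bounded_ray_def by (simp add: mono_on_filterlim_at_top_iff[OF mono_on_ray])
qed

text \<open>The ray of \<open>K\<close> lies below the ray of \<open>J\<close> at each parameter.
  With \<open>K\<close> a singleton, this turns a bound for \<open>J\<close> into the absence of an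
  arc to any element of \<open>J\<close>.\<close>

lemma bounded_ray_subset:
  assumes "bounded_ray J i" "K \<subseteq> J"
  shows "bounded_ray K i"
proof -
  obtain B where B: "\<And>t. 0 \<le> t \<Longrightarrow> f (1 + t *\<^sub>R ind_vec J) $ i \<le> B"
    using assms(1) by (rule bounded_rayE) blast
  show ?thesis
  proof (rule bounded_rayI)
    fix t :: real assume t: "0 \<le> t"
    have "f (1 + t *\<^sub>R ind_vec K) $ i \<le> f (1 + t *\<^sub>R ind_vec J) $ i"
      using t assms(2)
      by (intro topical_mono one_plus_ind_vec_nonneg) (auto simp: less_eq_vec_def ind_vec_def)
    then show "f (1 + t *\<^sub>R ind_vec K) $ i \<le> B" using B[OF t] by simp
  qed
qed

section \<open>Invariant faces and facial irreducibility\<close>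

lemma bounded_ray_imp_ind_vec_zero:
  assumes "bounded_ray J i"
  shows "f (ind_vec J) $ i = 0"
proof -
  obtain B where B: "\<And>t. 0 \<le> t \<Longrightarrow> f (1 + t *\<^sub>R ind_vec J) $ i \<le> B"
    using assms by (rule bounded_rayE) blast
  have scaled: "t * f (ind_vec J) $ i \<le> B" if t: "0 < t" for t
  proof -
    have "t * f (ind_vec J) $ i = f (t *\<^sub>R ind_vec J) $ i"
      using t by (simp add: topical_homogeneous ind_vec_nonneg)
    also have "\<dots> \<le> f (1 + t *\<^sub>R ind_vec J) $ i"
      using t by (intro topical_mono one_plus_ind_vec_nonneg scaleR_nonneg_orthant ind_vec_nonneg)
        (auto simp: less_eq_vec_def)
    also have "\<dots> \<le> B" using B t by simp
    finally show ?thesis .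
  qed
  have "f (ind_vec J) $ i \<le> 0"
  proof (rule ccontr)
    assume "\<not> ?thesis"
    then have pos: "0 < f (ind_vec J) $ i" by simp
    \<comment> \<open>The scaling factor is chosen so that the left side equals
      \<open>\<bar>B\<bar> + 1\<close>, which exceeds \<open>B\<close>.\<close>
    have "(\<bar>B\<bar> + 1) / f (ind_vec J) $ i * f (ind_vec J) $ i \<le> B"
      using pos by (intro scaled divide_pos_pos) auto
    then show False using pos by simp
  qed
  moreover have "0 \<le> f (ind_vec J) $ i"
    using topical_nonneg[OF ind_vec_nonneg] by (simp add: nonneg_orthant_def)
  ultimately show ?thesis by simp
qed

text \<open>Every point of the face lies below a positive multiple of \<open>ind_vec J\<close>, so
  by monotonicity and homogeneity this one vector decides invariance.\<close>

lemma face_invariant_iff: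
  "f ` closed_face J \<subseteq> closed_face J \<longleftrightarrow> (\<forall>i. i \<notin> J \<longrightarrow> f (ind_vec J) $ i = 0)"
proof
  assume "f ` closed_face J \<subseteq> closed_face J"
  moreover have "ind_vec J \<in> closed_face J"
    using ind_vec_nonneg by (auto simp: closed_face_def ind_vec_def)
  ultimately show "\<forall>i. i \<notin> J \<longrightarrow> f (ind_vec J) $ i = 0"
    by (auto simp: closed_face_def)
next
  assume zero: "\<forall>i. i \<notin> J \<longrightarrow> f (ind_vec J) $ i = 0"
  show "f ` closed_face J \<subseteq> closed_face J"
  proof clarify
    fix x assume x: "x \<in> closed_face J"
    then have xn: "x \<in> nonneg_orthant" by (simp add: closed_face_def)
    have "f x $ i = 0" if i: "i \<notin> J" for i
    proof -
      \<comment> \<open>The summand 1 keeps the factor positive for \<open>x = 0\<close>, as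
        homogeneity covers positive factors only.\<close>
      have M: "0 < norm x + 1" by (simp add: add_nonneg_pos)
      have "x \<le> (norm x + 1) *\<^sub>R ind_vec J"
        using x component_le_norm_cart[of x]
        by (auto simp: less_eq_vec_def ind_vec_def closed_face_def abs_le_iff add_increasing2)
      then have "f x $ i \<le> f ((norm x + 1) *\<^sub>R ind_vec J) $ i"
        using xn M by (intro topical_mono scaleR_nonneg_orthant ind_vec_nonneg) auto
      also have "\<dots> = 0"
        using topical_homogeneous[OF M ind_vec_nonneg] zero i by simp
      finally show ?thesis
        using topical_nonneg[OF xn] by (simp add: nonneg_orthant_def order_antisym)
    qed
    then show "f x \<in> closed_face J"
      using topical_nonneg[OF xn] by (simp add: closed_face_def)
  qed
qed

lemma facially_irreducible_imp_indecomposable: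
  assumes "facially_irreducible f"
  shows "indecomposable f"
proof
  assume "decomposable f"
  then obtain J where "J \<noteq> {}" "J \<noteq> UNIV" and "\<forall>i. i \<notin> J \<longrightarrow> bounded_ray J i"
    unfolding decomposable_iff_bounded_ray by blast
  moreover from this have "f ` closed_face J \<subseteq> closed_face J"
    unfolding face_invariant_iff by (simp add: bounded_ray_imp_ind_vec_zero)
  ultimately show False using assms unfolding facially_irreducible_def by blast
qed

lemma subadditive_indecomposable_imp_facially_irreducible:
  assumes sub: "subadditive_map f" and "indecomposable f"
  shows "facially_irreducible f"
proof -
  have bounded: "bounded_ray J i" if zero: "f (ind_vec J) $ i = 0" for J i
  proof (rule bounded_rayI)
    fix t :: real assume t: "0 \<le> t"
    have "f (1 + t *\<^sub>R ind_vec J) \<le> f 1 + f (t *\<^sub>R ind_vec J)"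
      using sub t unfolding subadditive_map_def
      by (blast intro: one_nonneg_orthant scaleR_nonneg_orthant ind_vec_nonneg)
    then have le: "f (1 + t *\<^sub>R ind_vec J) $ i \<le> f 1 $ i + f (t *\<^sub>R ind_vec J) $ i"
      by (simp add: less_eq_vec_def)
    show "f (1 + t *\<^sub>R ind_vec J) $ i \<le> f 1 $ i"
    \<comment> \<open>Homogeneity does not apply at \<open>t = 0\<close>, but there both sides are
      \<open>f 1 $ i\<close>.\<close>
    proof (cases "t = 0")
      case False
      then show ?thesis using le t zero by (simp add: topical_homogeneous ind_vec_nonneg)
    qed simp
  qed
  show ?thesis
    unfolding facially_irreducible_def face_invariant_iff
  proof clarify
    fix J assume "J \<noteq> {}" "J \<noteq> UNIV" "\<forall>i. i \<notin> J \<longrightarrow> f (ind_vec J) $ i = 0"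
    then have "decomposable f"
      unfolding decomposable_iff_bounded_ray by (simp add: bounded exI[of _ J])
    then show False using assms(2) by simp
  qed
qed

section \<open>Walks in the digraph and graphical irreducibility\<close>

lemma graph_closed_if_bounded_rays:
  assumes bounded: "\<And>i. i \<notin> J \<Longrightarrow> bounded_ray J i"
    and "u \<rightarrow>\<^sup>*\<^bsub>map_digraph f\<^esub> v" and "u \<notin> J"
  shows "v \<notin> J"
  using assms(2,3) unfolding reachable_def
proof (induction rule: rtrancl_on_induct)
  \<comment> \<open>The walk has stayed outside \<open>J\<close> up to \<open>w\<close>. If
    \<open>z\<close> were in \<open>J\<close>, the bound for \<open>J\<close> at \<open>w\<close>
    would restrict to \<open>{z}\<close> and exclude the arc from \<open>w\<close> to
    \<open>z\<close>.\<close>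
  case (step w z)
  then have "bounded_ray J w" "\<not> bounded_ray {z} w"
    using bounded arc_iff_not_bounded_ray by auto
  then show ?case using bounded_ray_subset[of J w "{z}"] by blast
qed

lemma graphically_irreducible_imp_indecomposable:
  assumes "graphically_irreducible f"
  shows "indecomposable f"
proof
  assume "decomposable f"
  then obtain J where "J \<noteq> {}" "J \<noteq> UNIV" and bounded: "\<And>i. i \<notin> J \<Longrightarrow> bounded_ray J i"
    unfolding decomposable_iff_bounded_ray by blast
  then obtain u v where "u \<notin> J" "v \<in> J" by blast
  moreover have "u \<rightarrow>\<^sup>*\<^bsub>map_digraph f\<^esub> v"
    using assms by (simp add: graphically_irreducible_def strongly_connected_def map_digraph_def)
  ultimately show False using graph_closed_if_bounded_rays[OF bounded] by blast
qed

section \<open>Geometric means of rays for m-convex maps\<close>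

lemma m_convex_bounded_ray_insert:
  assumes conv: "m_convex f" and "j \<notin> K" "bounded_ray K i" "bounded_ray {j} i"
  shows "bounded_ray (insert j K) i"
proof -
  obtain A where A: "\<And>t. 0 \<le> t \<Longrightarrow> f (1 + t *\<^sub>R ind_vec K) $ i \<le> A"
    using assms(3) by (rule bounded_rayE) blast
  obtain B where B: "\<And>t. 0 \<le> t \<Longrightarrow> f (1 + t *\<^sub>R ind_vec {j}) $ i \<le> B"
    using assms(4) by (rule bounded_rayE) blast
  show ?thesis
  proof (rule bounded_rayI)
    fix t :: real assume t: "0 \<le> t"
    \<comment> \<open>Chosen so that the square root of \<open>1 + s\<close> is
      \<open>1 + t\<close>. As \<open>j\<close> is not in \<open>K\<close>, each entry indexed by
      \<open>insert j K\<close> is \<open>1 + s\<close> in exactly one of \<open>?x\<close> and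
      \<open>?y\<close> and 1 in the other, so its geometric mean is \<open>1 + t\<close>.\<close>
    define s where "s = (1 + t)\<^sup>2 - 1"
    have s: "0 \<le> s" using t by (simp add: s_def power2_eq_square algebra_simps)
    let ?x = "1 + s *\<^sub>R ind_vec K" and ?y = "1 + s *\<^sub>R ind_vec {j}"
    have root: "(1 + s) powr (1/2) = 1 + t"
      using t by (simp add: s_def powr_half_sqrt)
    have pos: "?x \<in> pos_orthant" "?y \<in> pos_orthant"
      using s by (auto intro: one_plus_ind_vec_pos)
    have mean: "geom_mean (1/2) ?x ?y = 1 + t *\<^sub>R ind_vec (insert j K)"
      using root assms(2) by (auto simp: geom_mean_def vec_eq_iff ind_vec_def)
    have "f (geom_mean (1/2) ?x ?y) \<le> geom_mean (1/2) (f ?x) (f ?y)"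
      using conv pos unfolding m_convex_def by simp
    then have "f (1 + t *\<^sub>R ind_vec (insert j K)) $ i
        \<le> (f ?x $ i) powr (1/2) * (f ?y $ i) powr (1/2)"
      unfolding mean by (simp add: less_eq_vec_def geom_mean_def)
    \<comment> \<open>Positivity of \<open>f ?x\<close> and \<open>f ?y\<close> is what permits
      monotonicity of \<open>powr\<close> here.\<close>
    also have "\<dots> \<le> A powr (1/2) * B powr (1/2)"
      using A[OF s] B[OF s] topical_pos[OF pos(1)] topical_pos[OF pos(2)]
      by (intro mult_mono powr_mono2) (auto simp: pos_orthant_def less_imp_le)
    finally show "f (1 + t *\<^sub>R ind_vec (insert j K)) $ i \<le> A powr (1/2) * B powr (1/2)" .
  qed
qed

lemma m_convex_bounded_ray:
  assumes conv: "m_convex f" and "\<And>j. j \<in> J \<Longrightarrow> bounded_ray {j} i"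
  shows "bounded_ray J i"
  using finite[of J] assms(2)
proof (induction J rule: finite_induct)
  case empty
  have "ind_vec {} = (0 :: real ^ 'n)" by (simp add: ind_vec_def vec_eq_iff)
  then show ?case by (intro bounded_rayI[of _ _ "f 1 $ i"]) simp
next
  case (insert j K)
  have "bounded_ray K i" using insert.prems by (intro insert.IH) blast
  moreover have "bounded_ray {j} i" by (intro insert.prems) simp
  ultimately show ?case by (rule m_convex_bounded_ray_insert[OF conv insert.hyps(2)])
qed

lemma m_convex_indecomposable_imp_graphically_irreducible:
  assumes "m_convex f" and "indecomposable f"
  shows "graphically_irreducible f"
proof (rule ccontr)
  assume "\<not> ?thesis"
  then obtain u v where uv: "\<not> u \<rightarrow>\<^sup>*\<^bsub>map_digraph f\<^esub> v"
    by (auto simp: graphically_irreducible_def strongly_connected_def map_digraph_def)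
  \<comment> \<open>The nodes out of reach from \<open>u\<close> form the decomposing set:
    \<open>v\<close> makes it nonempty, \<open>u\<close> makes it proper, and an arc entering it
    from outside would make its head reachable.\<close>
  define J where "J = {w. \<not> u \<rightarrow>\<^sup>*\<^bsub>map_digraph f\<^esub> w}"
  \<comment> \<open>Reachability is a closure restricted to the vertex set, so even its reflexivity
    at \<open>u\<close> uses this fact.\<close>
  have UNIV: "verts (map_digraph f) = UNIV" by (simp add: map_digraph_def)
  have "v \<in> J" using uv by (simp add: J_def)
  moreover have "u \<notin> J" by (simp add: J_def reachable_def UNIV)
  moreover have "bounded_ray J i" if "i \<notin> J" for i
  proof (rule m_convex_bounded_ray[OF assms(1)], rule ccontr)
    fix j assume "j \<in> J" "\<not> bounded_ray {j} i"
    then have "i \<rightarrow>\<^bsub>map_digraph f\<^esub> j" by (simp add: arc_iff_not_bounded_ray)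
    then have "u \<rightarrow>\<^sup>*\<^bsub>map_digraph f\<^esub> j"
      using that unfolding J_def reachable_def by (auto intro: rtrancl_on_into_rtrancl_on simp: UNIV)
    then show False using \<open>j \<in> J\<close> by (simp add: J_def)
  qed
  ultimately have "decomposable f" unfolding decomposable_iff_bounded_ray by blast
  then show False using assms(2) by simp
qed

end

theorem theorem2p4:
  fixes f :: "real ^ 'n \<Rightarrow> real ^ 'n"
  assumes "m_topical f"
  shows "(facially_irreducible f \<or> graphically_irreducible f \<longrightarrow> indecomposable f) \<and>
         (m_convex f \<and> indecomposable f \<longrightarrow> graphically_irreducible f) \<and>
         (subadditive_map f \<and> indecomposable f \<longrightarrow> facially_irreducible f)"
  using facially_irreducible_imp_indecomposable[OF assms]
    graphically_irreducible_imp_indecomposable[OF assms]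
    m_convex_indecomposable_imp_graphically_irreducible[OF assms]
    subadditive_indecomposable_imp_facially_irreducible[OF assms]
  by blast

end
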